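(* Let $g:\mathbb{R}^n\to\mathbb{R}^m$ be a continuous function and let $P\subset\mathbb{R}^m$ be non-empty, convex and compact. Suppose that (i) $M:P\rightrightarrows\mathbb{R}^n$ is a lower semi-continuous and closed multi-valued map with convex values; (ii) $G:\mathbb{R}^n\rightrightarrows\mathbb{R}^n$ is an upper semi-continuous multi-valued map with non-empty, convex and compact values on the set $\mathrm{co}(M(P))$, where $M(P)=\bigcup_{p\in P}M(p)$. Assume that the coercivity condition $\mathcal{C}(p)$ holds, with constant $r_p>0$, for each $p\in P$, and that there exists some $r>\sup\{r_p : p\in P\}$ such that $M(p)\cap\bar B(0,r)\neq\emptyset$ for every $p\in P$. Then there exist $\bar p\in P$, $\bar y\in M(\bar p)$ and $\bar y^*\in G(\bar y)$ such that $$\langle g(\bar y),p-\bar p\rangle+\langle\bar y^*,z-\bar y\rangle\ge 0\quad\text{for all }(p,z)\in P\times M(\bar p).$$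
   Context: $\bar B(0,r)$ is the closed Euclidean ball of radius $r$ centred at $0$; $\mathrm{co}$ denotes convex hull. A multi-valued map is closed if its graph is closed. Coercivity condition $\mathcal{C}(p)$ with constant $r_p>0$: for every $y\in M(p)\setminus\bar B(0,r_p)$ there exists $z\in M(p)$ with $\|z\|<\|y\|$ such that $\langle y^*,y-z\rangle\ge 0$ for each $y^*\in G(y)$. *)

theory Defs
  imports "HOL-Analysis.Analysis"
begin

text \<open>A multi-valued map on a set \<open>S\<close> is represented by a total set-valued function of
  which only the values at points of \<open>S\<close> matter; semicontinuity is relative to \<open>S\<close>.
  Values may be empty. In both definitions the condition at \<open>x' = x\<close> itself is trivially
  true, so the punctured filter \<open>at x within S\<close> loses nothing.\<close>

definition lsc_on :: "'a::topological_space set \<Rightarrow> ('a \<Rightarrow> 'b::topological_space set) \<Rightarrow> bool" where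
  "lsc_on S T \<longleftrightarrow>
     (\<forall>x\<in>S. \<forall>V. open V \<and> T x \<inter> V \<noteq> {} \<longrightarrow> (\<forall>\<^sub>F x' in at x within S. T x' \<inter> V \<noteq> {}))"

definition usc_on :: "'a::topological_space set \<Rightarrow> ('a \<Rightarrow> 'b::topological_space set) \<Rightarrow> bool" where
  "usc_on S T \<longleftrightarrow>
     (\<forall>x\<in>S. \<forall>V. open V \<and> T x \<subseteq> V \<longrightarrow> (\<forall>\<^sub>F x' in at x within S. T x' \<subseteq> V))"

text \<open>The graph over \<open>S\<close> is required to be closed in the whole product space; for closed
  \<open>S\<close> this is the same as closedness in \<open>S \<times> UNIV\<close>.\<close>

definition closed_multimap_on :: "'a::topological_space set \<Rightarrow> ('a \<Rightarrow> 'b::topological_space set) \<Rightarrow> bool" where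
  "closed_multimap_on S T \<longleftrightarrow> closed {(x, y). x \<in> S \<and> y \<in> T x}"

definition coercivity ::
  "('p \<Rightarrow> 'a::real_inner set) \<Rightarrow> ('a \<Rightarrow> 'a set) \<Rightarrow> 'p \<Rightarrow> real \<Rightarrow> bool" where
  "coercivity M G p \<rho> \<longleftrightarrow>
     (\<forall>y \<in> M p - cball 0 \<rho>. \<exists>z \<in> M p. norm z < norm y \<and> (\<forall>y' \<in> G y. y' \<bullet> (y - z) \<ge> 0))"

end

theory Submission
  imports Defs
begin

text \<open>
  Truncate \<open>M\<close> to \<open>M p \<inter> cball 0 r\<close>. Coercivity forces each \<open>M p\<close> to meet the open ball of
  radius \<open>r\<close>, so by convexity the truncation is still lower semicontinuous, and Kakutani's
  theorem applies to the map sending \<open>(p, y, s)\<close> to the product of the minimisers of \<open>g y \<bullet> _\<close>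
  on \<open>P\<close>, the minimisers of \<open>s \<bullet> _\<close> on the truncated \<open>M p\<close>, and \<open>G y\<close>. A fixed point solves
  the truncated inequality. At such a solution \<open>s \<bullet> _\<close> also attains its minimum over the
  truncated set at a point of norm less than \<open>r\<close>, by coercivity when \<open>norm y = r\<close>, so this
  minimum is global on the convex set \<open>M p\<close>.
\<close>

section \<open>Kakutani's fixed point theorem\<close>

text \<open>The points of \<open>S\<close> at which a value leaves \<open>V\<close> form the
  projection of a compact piece \<open>C\<close> of the graph. This projection is closed and misses
  \<open>x\<close>, so its complement is the required neighbourhood.\<close>

lemma closed_multimap_imp_usc_on:
  fixes T :: "'a::metric_space \<Rightarrow> 'b::metric_space set"
  assumes "closed_multimap_on S T" "compact S" "compact K" "\<And>x. x \<in> S \<Longrightarrow> T x \<subseteq> K"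
  shows "usc_on S T"
  unfolding usc_on_def
proof (intro ballI allI impI)
  fix x V assume x: "x \<in> S" and V: "open V \<and> T x \<subseteq> V"
  define C where "C = {(x, y). x \<in> S \<and> y \<in> T x} \<inter> (S \<times> (K - V))"
  have "compact (K - V)"
    using V assms(3) by (simp add: compact_diff)
  then have "compact (S \<times> (K - V))"
    using assms(2) by (rule compact_Times[rotated])
  then have "compact C"
    using assms(1) unfolding C_def closed_multimap_on_def by (simp add: closed_Int_compact)
  then have "compact (fst ` C)"
    by (intro compact_continuous_image continuous_intros)
  then have "open (- (fst ` C))"
    by (simp add: compact_imp_closed open_Compl)
  moreover have "x \<in> - (fst ` C)"
    using V by (auto simp: C_def)
  moreover have "T x' \<subseteq> V" if "x' \<in> - (fst ` C)" "x' \<in> S" for x'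
  proof
    fix y assume "y \<in> T x'"
    show "y \<in> V"
    proof (rule ccontr)
      assume "y \<notin> V"
      then have "(x', y) \<in> C" using that \<open>y \<in> T x'\<close> assms(4) by (auto simp: C_def)
      then show False using that(1) by force
    qed
  qed
  ultimately show "\<forall>\<^sub>F x' in at x within S. T x' \<subseteq> V"
    unfolding eventually_at_topological by blast
qed

text \<open>Brouwer's theorem is applied to a continuous map \<open>h\<close> that blends arbitrary
  selections \<open>f a\<close> at the centres of a finite \<open>e\<close>-net by a partition of
  unity. At a fixed point only centres within \<open>e\<close> carry weight.\<close>

lemma approximate_fixed_point:
  fixes T :: "'a::euclidean_space \<Rightarrow> 'a set"
  assumes "compact S" "convex S" "S \<noteq> {}"
    and T: "\<And>x. x \<in> S \<Longrightarrow> T x \<noteq> {} \<and> T x \<subseteq> S" and "e > 0"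
  obtains x where "x \<in> S" "x \<in> convex hull (\<Union>a\<in>S \<inter> ball x e. T a)"
proof -
  obtain k where k: "finite k" "k \<subseteq> S" "S \<subseteq> (\<Union>a\<in>k. ball a e)"
  proof (rule compactE_image[OF assms(1), of S "\<lambda>a. ball a e"])
    show "S \<subseteq> (\<Union>a\<in>S. ball a e)" using \<open>e > 0\<close> by auto
  qed auto
  have "\<forall>x\<in>S. \<exists>y. y \<in> T x" using T by blast
  then obtain f where f: "\<And>x. x \<in> S \<Longrightarrow> f x \<in> T x" by metis
  \<comment> \<open>The tent \<open>w a\<close> is positive exactly on \<open>ball a e\<close>.
    These balls cover \<open>S\<close>, so \<open>W\<close> is positive there and the quotients
    \<open>w a x / W x\<close> are the partition of unity.\<close>
  define w where "w a x = max 0 (e - dist a x)" for a x :: 'a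
  define W where "W x = (\<Sum>a\<in>k. w a x)" for x
  define h where "h x = (\<Sum>a\<in>k. (w a x / W x) *\<^sub>R f a)" for x
  have w0: "w a x \<ge> 0" for a x by (simp add: w_def)
  have W: "W x > 0" if x: "x \<in> S" for x
  proof -
    obtain a where "a \<in> k" "x \<in> ball a e" using k(3) x by blast
    then have "0 < w a x" by (simp add: w_def)
    also have "\<dots> \<le> W x" unfolding W_def by (rule member_le_sum) (use \<open>a \<in> k\<close> k w0 in auto)
    finally show ?thesis .
  qed
  have W1: "(\<Sum>a\<in>k. w a x / W x) = 1" if "x \<in> S" for x
    using W[OF that] by (simp add: W_def flip: sum_divide_distrib)
  have "continuous_on S h"
    unfolding h_def
  proof (intro continuous_intros ballI)
    show "W x \<noteq> 0" if "x \<in> S" for x using W[OF that] by simp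
  qed (auto simp: W_def w_def intro!: continuous_intros)
  moreover have "h \<in> S \<rightarrow> S"
  proof
    fix x assume "x \<in> S"
    show "h x \<in> S"
      unfolding h_def
    proof (rule convex_sum[OF k(1) assms(2) W1[OF \<open>x \<in> S\<close>]])
      show "0 \<le> w i x / W x" for i using w0 W[OF \<open>x \<in> S\<close>] by (simp add: less_imp_le)
      show "f i \<in> S" if "i \<in> k" for i using that k f T by blast
    qed
  qed
  ultimately obtain x where x: "x \<in> S" "h x = x"
    using brouwer[OF assms(1,2,3)] by metis
  define k' where "k' = {a\<in>k. dist a x < e}"
  have k': "k' \<subseteq> k" "finite k'" using k by (auto simp: k'_def)
  have zero: "w a x = 0" if "a \<in> k - k'" for a
    using that by (auto simp: w_def k'_def)
  have "x = (\<Sum>a\<in>k'. (w a x / W x) *\<^sub>R f a)"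
    using x(2) unfolding h_def
    by (subst (asm) sum.mono_neutral_right[OF k(1) k'(1)]) (auto simp: zero)
  also have "\<dots> \<in> convex hull (\<Union>a\<in>S \<inter> ball x e. T a)"
  proof (rule convex_sum[OF k'(2) convex_convex_hull])
    show "(\<Sum>a\<in>k'. w a x / W x) = 1"
      using W1[OF x(1)] by (subst (asm) sum.mono_neutral_right[OF k(1) k'(1)]) (auto simp: zero)
    show "0 \<le> w i x / W x" for i using w0 W[OF x(1)] by (simp add: less_imp_le)
    show "f a \<in> convex hull (\<Union>a\<in>S \<inter> ball x e. T a)" if "a \<in> k'" for a
    proof (rule hull_inc)
      have "a \<in> S" "a \<in> ball x e" using that k by (auto simp: k'_def dist_commute)
      then show "f a \<in> (\<Union>a\<in>S \<inter> ball x e. T a)" using f by blast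
    qed
  qed
  finally show ?thesis using that x(1) by blast
qed

text \<open>Approximate fixed points for radii tending to 0 accumulate at some \<open>x\<close>. If
  \<open>x\<close> were outside \<open>T x\<close>, an open half-space would contain all values at
  points near \<open>x\<close>, hence also their convex hull and the approximate fixed points, while
  these converge to a point strictly on the other side.\<close>

theorem kakutani:
  fixes T :: "'a::euclidean_space \<Rightarrow> 'a set"
  assumes S: "compact S" "convex S" "S \<noteq> {}"
    and T: "\<And>x. x \<in> S \<Longrightarrow> T x \<noteq> {} \<and> T x \<subseteq> S \<and> convex (T x)"
    and graph: "closed_multimap_on S T"
  obtains x where "x \<in> S" "x \<in> T x"
proof -
  have "\<exists>x. x \<in> S \<and> x \<in> convex hull (\<Union>a\<in>S \<inter> ball x (1 / Suc n). T a)" for n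
    by (rule approximate_fixed_point[OF S, of T "1 / Suc n"]) (use T in auto)
  then obtain X where X: "\<And>n. X n \<in> S"
    "\<And>n. X n \<in> convex hull (\<Union>a\<in>S \<inter> ball (X n) (1 / Suc n). T a)"
    by metis
  obtain x \<sigma> where x: "x \<in> S" and \<sigma>: "strict_mono \<sigma>" and lim: "(X \<circ> \<sigma>) \<longlonglongrightarrow> x"
    using S(1) X(1) unfolding compact_def by metis
  have "x \<in> T x"
  proof (rule ccontr)
    assume "x \<notin> T x"
    \<comment> \<open>Strict separation needs \<open>T x\<close> closed; it is a section of the
      closed graph.\<close>
    have "T x = Pair x -` {(x, y). x \<in> S \<and> y \<in> T x}"
      using x by auto
    moreover have "closed (Pair x -` {(x, y). x \<in> S \<and> y \<in> T x})"
      using graph unfolding closed_multimap_on_def by (intro closed_vimage continuous_intros)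
    ultimately have "closed (T x)" by simp
    then obtain a b where ab: "a \<bullet> x < b" "\<And>y. y \<in> T x \<Longrightarrow> a \<bullet> y > b"
      using separating_hyperplane_closed_point T x \<open>x \<notin> T x\<close> by metis
    define V where "V = {y. a \<bullet> y > b}"
    have "usc_on S T"
      using closed_multimap_imp_usc_on[OF graph S(1) S(1)] T by blast
    then have "\<forall>\<^sub>F x' in at x within S. T x' \<subseteq> V"
      using x ab unfolding usc_on_def V_def by (metis mem_Collect_eq open_halfspace_gt subsetI)
    then obtain d where d: "d > 0" "\<And>x'. x' \<in> S \<Longrightarrow> dist x' x < d \<Longrightarrow> T x' \<subseteq> V"
      unfolding eventually_at using ab(2) by (metis V_def mem_Collect_eq subsetI)
    have "\<forall>\<^sub>F n in sequentially. a \<bullet> X (\<sigma> n) < b"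
      using lim ab(1) by (intro order_tendstoD(2)[OF tendsto_inner[OF tendsto_const]]) (auto simp: o_def)
    \<comment> \<open>Half of \<open>d\<close> is for the distance from
      \<open>X (\<sigma> n)\<close> to \<open>x\<close>, the other half for the radius of the ball
      around \<open>X (\<sigma> n)\<close>.\<close>
    moreover have "\<forall>\<^sub>F n in sequentially. dist (X (\<sigma> n)) x < d / 2"
      using tendstoD[OF lim, of "d / 2"] d(1) by simp
    moreover have "(\<lambda>n. 1 / Suc (\<sigma> n)) \<longlonglongrightarrow> 0"
      using LIMSEQ_subseq_LIMSEQ[OF LIMSEQ_inverse_real_of_nat \<sigma>] by (simp add: o_def inverse_eq_divide)
    then have "\<forall>\<^sub>F n in sequentially. 1 / Suc (\<sigma> n) < d / 2"
      using d(1) by (intro order_tendstoD(2)) auto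
    ultimately have "\<forall>\<^sub>F n in sequentially. False"
    proof eventually_elim
      case (elim n)
      have "T c \<subseteq> V" if "c \<in> S \<inter> ball (X (\<sigma> n)) (1 / Suc (\<sigma> n))" for c
      proof (rule d(2))
        show "dist c x < d"
          using that elim dist_triangle[of c x "X (\<sigma> n)"] by (auto simp: dist_commute)
      qed (use that in auto)
      moreover have "convex V" unfolding V_def by (rule convex_halfspace_gt)
      ultimately have "convex hull (\<Union>c\<in>S \<inter> ball (X (\<sigma> n)) (1 / Suc (\<sigma> n)). T c) \<subseteq> V"
        by (intro hull_minimal UN_least)
      then show False
        using X(2)[of "\<sigma> n"] elim by (auto simp: V_def)
    qed
    then show False by simp
  qed
  then show ?thesis using that x by blast
qed

section \<open>Semicontinuous maps\<close>

lemma usc_on_subset: "usc_on S T \<Longrightarrow> S' \<subseteq> S \<Longrightarrow> usc_on S' T"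
  unfolding usc_on_def by (meson at_le filter_leD subsetD)

text \<open>The sequence may hit \<open>x\<close> itself, which the punctured filter ignores; there
  the inclusion is the assumption on \<open>T x\<close>.\<close>

lemma usc_on_tendsto:
  assumes "usc_on S T" "x \<in> S" "open V" "T x \<subseteq> V" "X \<longlonglongrightarrow> x" "\<And>n. X n \<in> S"
  shows "\<forall>\<^sub>F n in sequentially. T (X n) \<subseteq> V"
proof -
  obtain U where U: "open U" "x \<in> U" "\<And>x'. x' \<in> U \<Longrightarrow> x' \<noteq> x \<Longrightarrow> x' \<in> S \<Longrightarrow> T x' \<subseteq> V"
    using assms(1-4) unfolding usc_on_def eventually_at_topological by metis
  have "\<forall>\<^sub>F n in sequentially. X n \<in> U"
    using assms(5) U(1,2) by (rule topological_tendstoD)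
  then show ?thesis
    by eventually_elim (use U(3) assms(4,6) in metis)
qed

lemma lsc_on_tendsto:
  assumes "lsc_on S T" "x \<in> S" "open V" "T x \<inter> V \<noteq> {}" "X \<longlonglongrightarrow> x" "\<And>n. X n \<in> S"
  shows "\<forall>\<^sub>F n in sequentially. T (X n) \<inter> V \<noteq> {}"
proof -
  obtain U where U: "open U" "x \<in> U" "\<And>x'. x' \<in> U \<Longrightarrow> x' \<noteq> x \<Longrightarrow> x' \<in> S \<Longrightarrow> T x' \<inter> V \<noteq> {}"
    using assms(1-4) unfolding lsc_on_def eventually_at_topological by metis
  have "\<forall>\<^sub>F n in sequentially. X n \<in> U"
    using assms(5) U(1,2) by (rule topological_tendstoD)
  then show ?thesis
    by eventually_elim (use U(3) assms(4,6) in metis)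
qed

text \<open>A closed ball around \<open>y\<close> that misses \<open>T x\<close> has an open
  complement containing \<open>T x\<close>, so it eventually misses every \<open>T (X n)\<close>,
  although \<open>Y n\<close> enters it.\<close>

lemma usc_on_limit_mem:
  fixes T :: "'a::topological_space \<Rightarrow> 'b::metric_space set"
  assumes "usc_on S T" "x \<in> S" "closed (T x)" "X \<longlonglongrightarrow> x" "\<And>n. X n \<in> S"
    and "Y \<longlonglongrightarrow> y" "\<And>n. Y n \<in> T (X n)"
  shows "y \<in> T x"
proof (rule ccontr)
  assume "y \<notin> T x"
  then obtain e where e: "e > 0" "cball y e \<subseteq> - T x"
    using open_contains_cball assms(3) by (metis ComplI open_Compl)
  have "\<forall>\<^sub>F n in sequentially. T (X n) \<subseteq> - cball y e"
    by (rule usc_on_tendsto[OF assms(1,2) _ _ assms(4,5)]) (use e in auto)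
  moreover have "\<forall>\<^sub>F n in sequentially. dist (Y n) y < e"
    using assms(6) e(1) by (rule tendstoD)
  ultimately have "\<forall>\<^sub>F n in sequentially. False"
    by eventually_elim (use assms(7) in \<open>fastforce simp: dist_commute\<close>)
  then show False by simp
qed

text \<open>Values escaping from ever larger balls would occur along a convergent sequence of
  points, but near its limit all values stay in one ball around the bounded limit value.\<close>

lemma usc_on_bounded_image:
  fixes T :: "'a::metric_space \<Rightarrow> 'b::real_normed_vector set"
  assumes "usc_on S T" "compact S" "\<And>x. x \<in> S \<Longrightarrow> bounded (T x)"
  obtains R where "\<And>x. x \<in> S \<Longrightarrow> T x \<subseteq> cball 0 R"
proof (rule ccontr)
  assume "\<not> thesis"
  then have "\<exists>x\<in>S. \<not> T x \<subseteq> cball 0 (real n)" for n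
    using that by blast
  then obtain X where X: "\<And>n. X n \<in> S" "\<And>n. \<not> T (X n) \<subseteq> cball 0 (real n)"
    by metis
  obtain x \<sigma> where x: "x \<in> S" and \<sigma>: "strict_mono \<sigma>" and lim: "(X \<circ> \<sigma>) \<longlonglongrightarrow> x"
    using assms(2) X(1) unfolding compact_def by metis
  obtain R where R: "T x \<subseteq> ball 0 R"
    using assms(3)[OF x] bounded_subset_ballD by blast
  have "\<forall>\<^sub>F n in sequentially. T ((X \<circ> \<sigma>) n) \<subseteq> ball 0 R"
    by (rule usc_on_tendsto[OF assms(1) x _ R lim]) (use X in auto)
  moreover have "\<forall>\<^sub>F n in sequentially. R \<le> real n"
    using eventually_ge_at_top[of "nat \<lceil>R\<rceil>"] by eventually_elim linarith
  ultimately have "\<forall>\<^sub>F n in sequentially. False"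
  proof eventually_elim
    case (elim n)
    have "R \<le> real (\<sigma> n)"
      using elim seq_suble[OF \<sigma>, of n] by linarith
    then have "ball 0 R \<subseteq> cball (0::'b) (real (\<sigma> n))" by auto
    then show False using elim X(2)[of "\<sigma> n"] by auto
  qed
  then show False by simp
qed

text \<open>This is what makes the graph of the minimiser map closed. Lower semicontinuity supplies
  nearby competitors only inside open sets, so competitors \<open>v\<close> with
  \<open>norm v < r\<close> come first; one on the sphere is then approached along the segment to
  \<open>w0\<close>.\<close>

lemma lsc_on_limit_argmin:
  fixes M :: "'p::topological_space \<Rightarrow> 'a::real_inner set"
  assumes "lsc_on P M" "p \<in> P" "convex (M p)" and w0: "w0 \<in> M p \<inter> ball 0 r"
    and lims: "X \<longlonglongrightarrow> p" "A \<longlonglongrightarrow> s" "Z \<longlonglongrightarrow> z" and X: "\<And>n. X n \<in> P"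
    and min: "\<And>n w. w \<in> M (X n) \<inter> cball 0 r \<Longrightarrow> A n \<bullet> (w - Z n) \<ge> 0"
    and w: "w \<in> M p \<inter> cball 0 r"
  shows "s \<bullet> (w - z) \<ge> 0"
proof -
  have interior: "s \<bullet> (v - z) \<ge> 0" if v: "v \<in> M p \<inter> ball 0 r" for v
  proof (rule ccontr)
    assume "\<not> s \<bullet> (v - z) \<ge> 0"
    \<comment> \<open>Joint continuity in the three arguments gives neighbourhoods \<open>B\<close>,
      \<open>C\<close>, \<open>V\<close> of \<open>s\<close>, \<open>z\<close>, \<open>v\<close> on
      whose product the inner product stays negative.\<close>
    define h where "h = (\<lambda>(s, z, v). s \<bullet> (v - z :: 'a))"
    have "((\<lambda>q. h q) \<longlongrightarrow> s \<bullet> (v - z)) (nhds s \<times>\<^sub>F nhds z \<times>\<^sub>F nhds v)"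
      unfolding h_def case_prod_unfold
      by (intro tendsto_intros filterlim_fst filterlim_compose[OF filterlim_fst filterlim_snd]
            filterlim_compose[OF filterlim_snd filterlim_snd])
    then have "\<forall>\<^sub>F q in nhds s \<times>\<^sub>F nhds z \<times>\<^sub>F nhds v. h q < 0"
      using \<open>\<not> s \<bullet> (v - z) \<ge> 0\<close> by (intro order_tendstoD(2)) auto
    then have "\<forall>\<^sub>F q in nhds (s, z, v). h q < 0"
      by (simp add: nhds_prod)
    then obtain U where U: "open U" "(s, z, v) \<in> U" "\<And>q. q \<in> U \<Longrightarrow> h q < 0"
      unfolding eventually_nhds by blast
    obtain B U' where B: "open B" "s \<in> B" "open U'" "(z, v) \<in> U'" "B \<times> U' \<subseteq> U"
      by (rule open_prod_elim[OF U(1,2)]) auto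
    obtain C V where C: "open C" "z \<in> C" "open V" "v \<in> V" "C \<times> V \<subseteq> U'"
      by (rule open_prod_elim[OF B(3,4)]) auto
    have "\<forall>\<^sub>F n in sequentially. M (X n) \<inter> (V \<inter> ball 0 r) \<noteq> {}"
      by (rule lsc_on_tendsto[OF assms(1,2) _ _ lims(1) X]) (use C v in auto)
    moreover have "\<forall>\<^sub>F n in sequentially. A n \<in> B"
      using lims(2) B(1,2) by (rule topological_tendstoD)
    moreover have "\<forall>\<^sub>F n in sequentially. Z n \<in> C"
      using lims(3) C(1,2) by (rule topological_tendstoD)
    ultimately have "\<forall>\<^sub>F n in sequentially. False"
    proof eventually_elim
      case (elim n)
      then obtain u where u: "u \<in> M (X n)" "u \<in> V" "u \<in> ball 0 r" by blast
      then have "A n \<bullet> (u - Z n) < 0"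
        using U(3)[of "(A n, Z n, u)"] B(5) C(5) elim by (auto simp: h_def)
      then show False using min[of u n] u by auto
    qed
    then show False by simp
  qed
  show ?thesis
  proof (rule ccontr)
    define a b where "a = s \<bullet> (w - z)" and "b = s \<bullet> (w0 - z)"
    \<comment> \<open>With this \<open>t\<close> the value \<open>(1 - t) * a + t * b\<close> equals
      \<open>a / 2\<close>, which is still negative, while \<open>t > 0\<close> pulls
      \<open>v\<close> into the open ball.\<close>
    define t where "t = (- a / 2) / (b - a)"
    assume "\<not> s \<bullet> (w - z) \<ge> 0"
    then have a: "a < 0" by (simp add: a_def)
    have b: "b \<ge> 0" using interior[OF w0] by (simp add: b_def)
    have t: "0 < t" "t < 1" using a b by (auto simp: t_def field_simps)
    define v where "v = (1 - t) *\<^sub>R w + t *\<^sub>R w0"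
    have "v \<in> M p"
      unfolding v_def using assms(3) w w0 t by (intro convexD) auto
    moreover have "norm v < r"
    proof -
      have "norm v \<le> (1 - t) * norm w + t * norm w0"
        unfolding v_def using norm_triangle_ineq[of "(1 - t) *\<^sub>R w" "t *\<^sub>R w0"] t by simp
      also have "\<dots> < (1 - t) * r + t * r"
        using t w w0 by (intro add_le_less_mono mult_left_mono mult_strict_left_mono) auto
      finally show ?thesis by (simp add: algebra_simps)
    qed
    ultimately have "s \<bullet> (v - z) \<ge> 0" by (intro interior) auto
    moreover have "s \<bullet> (v - z) = (1 - t) * a + t * b"
      by (simp add: v_def a_def b_def algebra_simps inner_add_right inner_diff_right)
    moreover have "t * (b - a) = - a / 2"
      using a b nonzero_eq_divide_eq[of "b - a" t "- a / 2"] t_def by linarith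
    then have "(1 - t) * a + t * b = a / 2"
      by (simp add: algebra_simps)
    ultimately show False using a by simp
  qed
qed

section \<open>Minimisers of a linear functional\<close>

lemma argmin_inner_exists:
  fixes C :: "'a::real_inner set"
  assumes "compact C" "C \<noteq> {}"
  obtains z where "z \<in> C" "\<And>w. w \<in> C \<Longrightarrow> s \<bullet> (w - z) \<ge> 0"
proof -
  have "continuous_on C (\<lambda>z. s \<bullet> z)" by (intro continuous_intros)
  then obtain z where "z \<in> C" "\<forall>w\<in>C. s \<bullet> z \<le> s \<bullet> w"
    using continuous_attains_inf[OF assms] by blast
  then show ?thesis using that by (simp add: inner_diff_right)
qed

lemma convex_argmin_inner:
  fixes C :: "'a::real_inner set"
  assumes "convex C"
  shows "convex {z\<in>C. \<forall>w\<in>C. s \<bullet> (w - z) \<ge> 0}"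
proof -
  have "{z\<in>C. \<forall>w\<in>C. s \<bullet> (w - z) \<ge> 0} = C \<inter> (\<Inter>w\<in>C. {z. s \<bullet> z \<le> s \<bullet> w})"
    by (auto simp: inner_diff_right)
  then show ?thesis
    using assms by (simp add: convex_Int convex_INT convex_halfspace_le)
qed

section \<open>The quasi-variational inequality\<close>

text \<open>Keeping \<open>s\<close> as a separate coordinate makes each factor of \<open>T\<close>
  convex-valued, and a fixed point of \<open>T\<close> is exactly a solution. The points of
  \<open>M p\<close> in the open ball serve as \<open>w0\<close> in
  \<open>lsc_on_limit_argmin\<close>.\<close>

lemma truncated_quasi_variational_inequality:
  fixes g :: "'a::euclidean_space \<Rightarrow> 'p::euclidean_space"
    and M :: "'p \<Rightarrow> 'a set" and G :: "'a \<Rightarrow> 'a set"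
  assumes g: "continuous_on UNIV g"
    and P: "P \<noteq> {}" "convex P" "compact P"
    and M: "lsc_on P M" "closed_multimap_on P M" "\<And>p. p \<in> P \<Longrightarrow> convex (M p)"
      "\<And>p. p \<in> P \<Longrightarrow> M p \<inter> ball 0 r \<noteq> {}"
    and G: "usc_on (convex hull (\<Union>p\<in>P. M p)) G"
      "\<And>y. y \<in> convex hull (\<Union>p\<in>P. M p) \<Longrightarrow> G y \<noteq> {} \<and> convex (G y) \<and> compact (G y)"
  obtains p y s where "p \<in> P" "y \<in> M p \<inter> cball 0 r" "s \<in> G y"
    "\<And>q. q \<in> P \<Longrightarrow> g y \<bullet> (q - p) \<ge> 0"
    "\<And>z. z \<in> M p \<inter> cball 0 r \<Longrightarrow> s \<bullet> (z - y) \<ge> 0"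
proof -
  define Mr where "Mr p = M p \<inter> cball 0 r" for p
  define Gr where "Gr = {(p, y). p \<in> P \<and> y \<in> Mr p}"
  have "Gr = {(p, y). p \<in> P \<and> y \<in> M p} \<inter> P \<times> cball 0 r"
    by (auto simp: Gr_def Mr_def)
  then have Gr: "compact Gr"
    using M(2) P(3) unfolding closed_multimap_on_def
    by (simp add: closed_Int_compact compact_Times)
  \<comment> \<open>\<open>D\<close> is a compact convex domain for the \<open>y\<close> coordinate:
    it contains every truncated value and lies in the hull on which \<open>G\<close> is
    controlled.\<close>
  define D where "D = convex hull (snd ` Gr)"
  have D: "compact D" "convex D"
    unfolding D_def by (auto intro!: compact_convex_hull compact_continuous_image Gr continuous_intros)
  have MrD: "Mr p \<subseteq> D" if "p \<in> P" for p
    unfolding D_def using that by (force intro!: hull_inc simp: Gr_def)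
  have DH: "D \<subseteq> convex hull (\<Union>p\<in>P. M p)"
    unfolding D_def by (rule hull_mono) (auto simp: Gr_def Mr_def)
  have Mr: "Mr p \<noteq> {}" "convex (Mr p)" "compact (Mr p)" if "p \<in> P" for p
  proof -
    show "Mr p \<noteq> {}" using M(4)[OF that] by (force simp: Mr_def)
    show "convex (Mr p)" using M(3)[OF that] by (simp add: Mr_def convex_Int)
    have "Mr p = snd ` (Gr \<inter> {p} \<times> UNIV)" using that by (force simp: Gr_def)
    moreover have "compact (Gr \<inter> {p} \<times> UNIV)"
      using Gr by (intro compact_Int_closed closed_Times) auto
    ultimately show "compact (Mr p)"
      by (auto intro!: compact_continuous_image continuous_intros)
  qed
  have GD: "usc_on D G" using usc_on_subset[OF G(1) DH] .
  have G': "G y \<noteq> {}" "convex (G y)" "compact (G y)" if "y \<in> D" for y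
    using G(2) DH that by auto
  \<comment> \<open>A common bound for the values of \<open>G\<close> on \<open>D\<close> makes
    \<open>cball 0 R\<close> a compact convex domain for the \<open>s\<close> coordinate.\<close>
  obtain R where R: "\<And>y. y \<in> D \<Longrightarrow> G y \<subseteq> cball 0 R"
    using usc_on_bounded_image[OF GD D(1)] G'(3) compact_imp_bounded by metis
  define AP where "AP y = {p\<in>P. \<forall>q\<in>P. g y \<bullet> (q - p) \<ge> 0}" for y
  define AM where "AM p s = {z\<in>Mr p. \<forall>w\<in>Mr p. s \<bullet> (w - z) \<ge> 0}" for p s
  define T where "T = (\<lambda>(p, y, s). AP y \<times> AM p s \<times> G y)"
  define S where "S = P \<times> D \<times> cball (0::'a) R"
  obtain p0 where p0: "p0 \<in> P" using P(1) by blast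
  obtain y0 where y0: "y0 \<in> D" using Mr(1)[OF p0] MrD[OF p0] by blast
  have "cball (0::'a) R \<noteq> {}" using G'(1)[OF y0] R[OF y0] by blast
  then have S: "compact S" "convex S" "S \<noteq> {}"
    unfolding S_def using P D p0 y0 by (auto intro!: compact_Times convex_Times)
  have T: "T x \<noteq> {} \<and> T x \<subseteq> S \<and> convex (T x)" if "x \<in> S" for x
  proof -
    obtain p y s where x: "x = (p, y, s)" "p \<in> P" "y \<in> D" "s \<in> cball 0 R"
      using \<open>x \<in> S\<close> by (auto simp: S_def)
    have "AP y \<noteq> {}"
      unfolding AP_def by (rule argmin_inner_exists[OF P(3,1), of "g y"]) auto
    moreover have "AM p s \<noteq> {}"
      unfolding AM_def by (rule argmin_inner_exists[OF Mr(3)[OF x(2)] Mr(1)[OF x(2)], of s]) auto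
    moreover have "convex (AP y)" "convex (AM p s)"
      unfolding AP_def AM_def using convex_argmin_inner P(2) Mr(2)[OF x(2)] by blast+
    moreover have "AP y \<subseteq> P" "AM p s \<subseteq> D"
      using MrD[OF x(2)] by (auto simp: AP_def AM_def)
    ultimately show ?thesis
      using G'[OF x(3)] R[OF x(3)] unfolding T_def S_def x(1) by (auto intro!: convex_Times)
  qed
  \<comment> \<open>The limit is checked factor by factor: continuity of \<open>g\<close> for
    \<open>p'\<close>, compactness of \<open>Gr\<close> and \<open>lsc_on_limit_argmin\<close> for
    \<open>z\<close>, upper semicontinuity of \<open>G\<close> for \<open>s'\<close>.\<close>
  have "closed_multimap_on S T"
    unfolding closed_multimap_on_def closed_sequential_limits
  proof (intro allI impI, elim conjE)
    fix X and l :: "('p \<times> 'a \<times> 'a) \<times> 'p \<times> 'a \<times> 'a"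
    assume X: "\<forall>n. X n \<in> {(x, y). x \<in> S \<and> y \<in> T x}" and lim: "X \<longlonglongrightarrow> l"
    obtain p y s p' z s' where l: "l = ((p, y, s), (p', z, s'))" by (metis prod.exhaust)
    define pn yn sn pn' zn sn' where
      "pn n = fst (fst (X n))" and "yn n = fst (snd (fst (X n)))" and "sn n = snd (snd (fst (X n)))"
      and "pn' n = fst (snd (X n))" and "zn n = fst (snd (snd (X n)))" and "sn' n = snd (snd (snd (X n)))"
      for n
    note defs = pn_def yn_def sn_def pn'_def zn_def sn'_def
    have "X n = ((pn n, yn n, sn n), (pn' n, zn n, sn' n))" for n by (simp add: defs)
    then have mem: "pn n \<in> P" "yn n \<in> D" "sn n \<in> cball 0 R" "pn' n \<in> AP (yn n)"
        "zn n \<in> AM (pn n) (sn n)" "sn' n \<in> G (yn n)" for n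
      using X[rule_format, of n] by (auto simp: S_def T_def)
    have lims: "pn \<longlonglongrightarrow> p" "yn \<longlonglongrightarrow> y" "sn \<longlonglongrightarrow> s" "pn' \<longlonglongrightarrow> p'" "zn \<longlonglongrightarrow> z" "sn' \<longlonglongrightarrow> s'"
      using tendsto_fst[OF tendsto_fst[OF lim]]
        tendsto_fst[OF tendsto_snd[OF tendsto_fst[OF lim]]]
        tendsto_snd[OF tendsto_snd[OF tendsto_fst[OF lim]]]
        tendsto_fst[OF tendsto_snd[OF lim]]
        tendsto_fst[OF tendsto_snd[OF tendsto_snd[OF lim]]]
        tendsto_snd[OF tendsto_snd[OF tendsto_snd[OF lim]]]
      by (simp_all add: defs[abs_def] l)
    have cl: "closed P" "closed D" using P D compact_imp_closed by auto
    have p: "p \<in> P" and y: "y \<in> D" and s: "s \<in> cball 0 R"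
      using closed_sequentially[OF cl(1) _ lims(1)] closed_sequentially[OF cl(2) _ lims(2)]
        closed_sequentially[OF closed_cball _ lims(3)] mem by blast+
    have "p' \<in> P"
      using closed_sequentially[OF cl(1) _ lims(4)] mem(4) by (auto simp: AP_def)
    moreover have "g y \<bullet> (q - p') \<ge> 0" if "q \<in> P" for q
    proof (rule LIMSEQ_le_const)
      have "(\<lambda>n. g (yn n)) \<longlonglongrightarrow> g y"
        using continuous_on_tendsto_compose[OF g lims(2)] by simp
      then show "(\<lambda>n. g (yn n) \<bullet> (q - pn' n)) \<longlonglongrightarrow> g y \<bullet> (q - p')"
        by (intro tendsto_intros lims)
      show "\<exists>N. \<forall>n\<ge>N. 0 \<le> g (yn n) \<bullet> (q - pn' n)"
        using mem(4) that by (auto simp: AP_def)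
    qed
    ultimately have "p' \<in> AP y" by (simp add: AP_def)
    moreover have "(p, z) \<in> Gr"
    proof (rule closed_sequentially[OF compact_imp_closed[OF Gr]])
      show "(pn n, zn n) \<in> Gr" for n
        using mem(1,5)[of n] by (auto simp: Gr_def AM_def)
      show "(\<lambda>n. (pn n, zn n)) \<longlonglongrightarrow> (p, z)" by (intro tendsto_Pair lims)
    qed
    moreover have "s \<bullet> (w - z) \<ge> 0" if "w \<in> Mr p" for w
    proof -
      obtain w0 where w0: "w0 \<in> M p \<inter> ball 0 r" using M(4)[OF p] by blast
      show ?thesis
        by (rule lsc_on_limit_argmin[OF M(1) p M(3)[OF p] w0 lims(1,3,5) mem(1)])
          (use mem(5) that in \<open>auto simp: AM_def Mr_def\<close>)
    qed
    moreover have "s' \<in> G y"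
      using usc_on_limit_mem[OF GD y _ lims(2) mem(2) lims(6) mem(6)] G'(3)[OF y] compact_imp_closed
      by blast
    ultimately show "l \<in> {(x, y). x \<in> S \<and> y \<in> T x}"
      using p y s by (auto simp: l S_def T_def AM_def Gr_def)
  qed
  then obtain x where "x \<in> S" "x \<in> T x" using kakutani[OF S, of T] T by blast
  then obtain p y s where "p \<in> P" "p \<in> AP y" "y \<in> AM p s" "s \<in> G y"
    by (auto simp: S_def T_def)
  then show ?thesis using that[of p y s] by (auto simp: AP_def AM_def Mr_def)
qed

section \<open>Removing the truncation\<close>

text \<open>Since \<open>norm y < r\<close>, a short step from \<open>y\<close> towards
  \<open>z\<close> stays in the ball, and the functional changes along it by \<open>t\<close> times
  its change from \<open>y\<close> to \<open>z\<close>.\<close>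

lemma argmin_inner_truncation:
  fixes C :: "'a::real_inner set"
  assumes "convex C" "y \<in> C" "norm y < r"
    and min: "\<And>z. z \<in> C \<inter> cball 0 r \<Longrightarrow> s \<bullet> (z - y) \<ge> 0" and z: "z \<in> C"
  shows "s \<bullet> (z - y) \<ge> 0"
proof -
  \<comment> \<open>The summand \<open>r - norm y\<close> in the denominator keeps it positive even
    for \<open>z = y\<close> and ensures \<open>t \<le> 1\<close>.\<close>
  define t where "t = (r - norm y) / (r - norm y + norm (z - y))"
  have pos: "r - norm y + norm (z - y) > 0"
    using assms(3) by (simp add: add_pos_nonneg)
  have t: "0 < t" "t \<le> 1" using assms(3) pos by (auto simp: t_def)
  have "t * norm (z - y) \<le> t * (r - norm y + norm (z - y))"
    using t assms(3) by (intro mult_left_mono) auto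
  also have "\<dots> = r - norm y"
    using pos by (simp add: t_def)
  finally have tz: "t * norm (z - y) \<le> r - norm y" .
  define v where "v = (1 - t) *\<^sub>R y + t *\<^sub>R z"
  have vy: "v = y + t *\<^sub>R (z - y)" by (simp add: v_def algebra_simps)
  have "norm v \<le> norm y + t * norm (z - y)"
    using norm_triangle_ineq[of y "t *\<^sub>R (z - y)"] t by (simp add: vy)
  then have "norm v \<le> r" using tz by simp
  moreover have "v \<in> C"
    unfolding v_def using assms(1,2) z t by (intro convexD) auto
  ultimately have "s \<bullet> (v - y) \<ge> 0" by (intro min) auto
  then show ?thesis using t by (simp add: vy zero_le_mult_iff)
qed

theorem theorem3p4:
  fixes g :: "real ^ 'n \<Rightarrow> real ^ 'm"
    and P :: "(real ^ 'm) set"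
    and M :: "real ^ 'm \<Rightarrow> (real ^ 'n) set"
    and G :: "real ^ 'n \<Rightarrow> (real ^ 'n) set"
    and rad :: "real ^ 'm \<Rightarrow> real"
  assumes "continuous_on UNIV g"
    and "P \<noteq> {}" and "convex P" and "compact P"
    and "lsc_on P M" and "closed_multimap_on P M"
    and "\<And>p. p \<in> P \<Longrightarrow> convex (M p)"
    and "usc_on (convex hull (\<Union>p\<in>P. M p)) G"
    and "\<And>y. y \<in> convex hull (\<Union>p\<in>P. M p) \<Longrightarrow> G y \<noteq> {} \<and> convex (G y) \<and> compact (G y)"
    and "\<And>p. p \<in> P \<Longrightarrow> rad p > 0 \<and> coercivity M G p (rad p)"
    and "\<exists>r::real. ereal r > (SUP p\<in>P. ereal (rad p)) \<and> (\<forall>p\<in>P. M p \<inter> cball 0 r \<noteq> {})"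
  shows "\<exists>p0\<in>P. \<exists>y0 \<in> M p0. \<exists>y0' \<in> G y0.
           \<forall>p\<in>P. \<forall>z \<in> M p0. g y0 \<bullet> (p - p0) + y0' \<bullet> (z - y0) \<ge> 0"
proof -
  obtain r where r: "ereal r > (SUP p\<in>P. ereal (rad p))"
    and meet: "\<And>p. p \<in> P \<Longrightarrow> M p \<inter> cball 0 r \<noteq> {}"
    using assms(11) by blast
  \<comment> \<open>Because \<open>r\<close> strictly exceeds each \<open>rad p\<close>, coercivity
    applies on the sphere \<open>norm y = r\<close>.\<close>
  have rad: "rad p < r" if "p \<in> P" for p
    using SUP_upper[OF that, of "\<lambda>p. ereal (rad p)"] r by (metis less_ereal.simps(1) order.strict_trans1)
  have coerc: "\<exists>z\<in>M p. norm z < norm y \<and> (\<forall>s\<in>G y. s \<bullet> (y - z) \<ge> 0)"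
    if "p \<in> P" "y \<in> M p" "norm y = r" for p y
    using assms(10)[OF that(1)] rad[OF that(1)] that unfolding coercivity_def by auto
  have "M p \<inter> ball 0 r \<noteq> {}" if p: "p \<in> P" for p
  proof -
    obtain y where "y \<in> M p" "norm y \<le> r" using meet[OF p] by auto
    then show ?thesis using coerc[OF p, of y] by (cases "norm y = r") auto
  qed
  then obtain p y s where py: "p \<in> P" "y \<in> M p \<inter> cball 0 r" "s \<in> G y"
    and gP: "\<And>q. q \<in> P \<Longrightarrow> g y \<bullet> (q - p) \<ge> 0"
    and min: "\<And>z. z \<in> M p \<inter> cball 0 r \<Longrightarrow> s \<bullet> (z - y) \<ge> 0"
    using truncated_quasi_variational_inequality[OF assms(1-7) _ assms(8,9)] by blast
  \<comment> \<open>\<open>u\<close> is \<open>y\<close> itself when \<open>norm y < r\<close>, and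
    otherwise the shorter point given by coercivity.\<close>
  obtain u where u: "u \<in> M p" "norm u < r" "s \<bullet> (y - u) \<ge> 0"
  proof (cases "norm y = r")
    case True
    then show ?thesis using coerc[OF py(1), of y] py that by auto
  next
    case False
    then show ?thesis using that[of y] py by auto
  qed
  \<comment> \<open>\<open>u\<close> does at least as well as \<open>y\<close>, so it also minimises
    over the truncated set, and then over all of \<open>M p\<close> as it lies in the open ball.
    Minimality of \<open>y\<close> against \<open>u\<close> carries this back to
    \<open>y\<close>.\<close>
  have "s \<bullet> (z - y) \<ge> 0" if "z \<in> M p" for z
  proof -
    have "s \<bullet> (w - u) \<ge> 0" if "w \<in> M p \<inter> cball 0 r" for w
      using min[OF that] u(3) by (simp add: inner_diff_right)
    then have "s \<bullet> (z - u) \<ge> 0"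
      using argmin_inner_truncation[OF assms(7)[OF py(1)] u(1,2)] \<open>z \<in> M p\<close> by blast
    moreover have "s \<bullet> (u - y) \<ge> 0" using min u by auto
    ultimately show ?thesis by (simp add: inner_diff_right)
  qed
  then show ?thesis using py gP by (metis IntD1 add_nonneg_nonneg)
qed

end
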